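(* Let $j\ge 0$, and let the normalized lift $\Gamma$ of an arclength-parametrized L-curve in $S^3$ (with normalized framing $(\Gamma,T,N)$ and curvature $k$) evolve according to $$\Gamma_t=\left(-a'-\tfrac16 i\,(u h+h'')\right)\Gamma+(a+\tfrac12 i h')T+hN,$$ where $u=-2k$, $h=L_j[u]$ and $$a=\tfrac1{18}\left[M_j+\left(D^4+5uD^2+\tfrac52u_xD+u_{xx}+2u^2\right)L_j\right].$$ Then $u$ satisfies $$u_t=\tfrac19K_{j+2}[u]-3K_j[u].$$
   Context: Geometric setting. On $\mathbb{C}^3$ let $\langle \mathbf z,\mathbf w\rangle = -z_0\overline{w_0}+z_1\overline{w_1}+z_2\overline{w_2}$, let $\mathcal N$ be the cone of nonzero null vectors, $\pi:\mathbb{C}^3\setminus\{0\}\to\mathbb{C}P^2$ the projectivization, and identify $S^3$ with $\pi(\mathcal N)$. An L-curve is a regular parametrized curve $\gamma:I\to S^3$ having a lift $\Gamma:I\to\mathcal N$ with $\langle\Gamma_x,\Gamma\rangle=0$. A null frame is a triple $(e_0,e_1,e_2)$ of vectors in $\mathbb C^3$ with $\langle e_0,e_0\rangle=\langle e_0,e_1\rangle=\langle e_2,e_1\rangle=\langle e_2,e_2\rangle=0$, $\langle e_2,e_0\rangle=i$, $\langle e_0,e_2\rangle=-i$, $\langle e_1,e_1\rangle=1$, $\det(e_0,e_1,e_2)=1$. A normalized framing of an L-curve $\gamma$ is a null frame field $(\Gamma,T,N)$ along $\gamma$ with $\pi\circ\Gamma=\gamma$ and $\Gamma_x=T$, $T_x=iN+k\Gamma$,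 $N_x=\ell\Gamma-ikT$ for real-valued functions $k,\ell$; $\Gamma$ is then the normalized lift. The L-curve is arclength-parametrized if $\ell=1$ identically. (The functions $a,h$ above satisfy the identity needed for the flow to be compatible with $\ell=1$ for all $t$, so the evolving curve is understood to be arclength-parametrized for every $t$.) Kaup-Kuperschmidt hierarchy. Prime and $D$ denote the (total) derivative with respect to $x$. Set $$K_0[u]=u',\qquad K_1[u]=u^{(5)}+5uu'''+\tfrac{25}2u'u''+5u^2u',$$ and $K_{j+2}=\mathfrak R K_j$ for $j\ge0$, where $$\mathfrak R=D^6+6uD^4+18u'D^3+(9u^2+\tfrac{49}2u'')D^2+(30u'u+\tfrac{35}2u''')D+\tfrac{13}2u''''+\tfrac{41}2u''u+\tfrac{69}4(u')^2+4u^3+K_1[u]D^{-1}+\tfrac12u'D^{-1}\circ(u''+2u^2).$$ It is known that all $K_j$ are differential polynomials in $u$ and that for each $j\ge 0$ there are local functions (functions of $u$ and finitely many of its $x$-derivatives) $L_j[u]$, $M_j[u]$ with $K_j=DL_j$ and $(u''+2u^2)K_j=DM_j$; in $\mathfrak R K_j$ one takes $D^{-1}K_j=L_j$ and $D^{-1}\big((u''+2u^2)K_j\big)=M_j$. *)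

theory Defs
  imports "HOL-Analysis.Analysis"
begin

section \<open>Smooth maps\<close>

primrec Ck_on :: "nat \<Rightarrow> 'a::real_normed_vector set \<Rightarrow> ('a \<Rightarrow> 'b::real_normed_vector) \<Rightarrow> bool" where
  "Ck_on 0 S f \<longleftrightarrow> continuous_on S f"
| "Ck_on (Suc n) S f \<longleftrightarrow> (\<forall>x\<in>S. f differentiable (at x)) \<and>
     (\<forall>v. Ck_on n S (\<lambda>x. frechet_derivative f (at x) v))"

text \<open>Intended for open sets in finite-dimensional spaces, where it is the usual notion.\<close>
definition smooth_on :: "'a::real_normed_vector set \<Rightarrow> ('a \<Rightarrow> 'b::real_normed_vector) \<Rightarrow> bool" where
  "smooth_on S f \<longleftrightarrow> (\<forall>n. Ck_on n S f)"

section \<open>Geometry of the null cone\<close>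

text \<open>The coordinates $z_0, z_1, z_2$ are \<open>z $ 1\<close>, \<open>z $ 2\<close>, \<open>z $ 3\<close>.\<close>
definition herm :: "complex^3 \<Rightarrow> complex^3 \<Rightarrow> complex" where
  "herm z w = - (z $ 1) * cnj (w $ 1) + z $ 2 * cnj (w $ 2) + z $ 3 * cnj (w $ 3)"

definition null_cone :: "(complex^3) set" where
  "null_cone = {z. z \<noteq> 0 \<and> herm z z = 0}"

text \<open>Points of the complex projective plane are complex lines through the origin.\<close>
definition proj :: "complex^3 \<Rightarrow> (complex^3) set" where
  "proj z = range (\<lambda>c. c *s z)"

definition S3 :: "(complex^3) set set" where
  "S3 = proj ` null_cone"

text \<open>The kernel of the differential of \<^const>\<open>proj\<close> at \<open>z\<close> is the complex line spanned by \<open>z\<close>,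
  so the last condition says that \<open>\<gamma>\<close> has nonvanishing velocity.\<close>
definition L_curve :: "real set \<Rightarrow> (real \<Rightarrow> (complex^3) set) \<Rightarrow> bool" where
  "L_curve I \<gamma> \<longleftrightarrow> \<gamma> ` I \<subseteq> S3 \<and>
     (\<exists>\<Gamma>. smooth_on I \<Gamma> \<and>
       (\<forall>x\<in>I. \<Gamma> x \<in> null_cone \<and> proj (\<Gamma> x) = \<gamma> x \<and>
          herm (vector_derivative \<Gamma> (at x)) (\<Gamma> x) = 0 \<and>
          (\<forall>c. vector_derivative \<Gamma> (at x) \<noteq> c *s \<Gamma> x)))"

text \<open>The vectors are the rows rather than the columns of the matrix, which does not change
  the determinant.\<close>
definition null_frame :: "complex^3 \<Rightarrow> complex^3 \<Rightarrow> complex^3 \<Rightarrow> bool" where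
  "null_frame e0 e1 e2 \<longleftrightarrow>
     herm e0 e0 = 0 \<and> herm e0 e1 = 0 \<and> herm e2 e1 = 0 \<and> herm e2 e2 = 0 \<and>
     herm e2 e0 = \<i> \<and> herm e0 e2 = - \<i> \<and> herm e1 e1 = 1 \<and>
     det (vector [e0, e1, e2] :: complex^3^3) = 1"

definition normalized_framing ::
  "real set \<Rightarrow> (real \<Rightarrow> (complex^3) set) \<Rightarrow> (real \<Rightarrow> complex^3) \<Rightarrow> (real \<Rightarrow> complex^3) \<Rightarrow>
   (real \<Rightarrow> complex^3) \<Rightarrow> (real \<Rightarrow> real) \<Rightarrow> (real \<Rightarrow> real) \<Rightarrow> bool" where
  "normalized_framing I \<gamma> \<Gamma> T N k l \<longleftrightarrow> L_curve I \<gamma> \<and>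
     (\<forall>x\<in>I. null_frame (\<Gamma> x) (T x) (N x) \<and> proj (\<Gamma> x) = \<gamma> x \<and>
        (\<Gamma> has_vector_derivative T x) (at x) \<and>
        (T has_vector_derivative (\<i> *s N x + of_real (k x) *s \<Gamma> x)) (at x) \<and>
        (N has_vector_derivative (of_real (l x) *s \<Gamma> x - (\<i> * of_real (k x)) *s T x)) (at x))"

section \<open>Local functions of \<open>u\<close> and its derivatives\<close>

text \<open>A function of $u, u', u'', \ldots$ is a function of the sequence \<open>v\<close> of jet coordinates,
  where \<open>v n\<close> stands for the \<open>n\<close>-th derivative of \<open>u\<close>.\<close>
type_synonym jet_fun = "(nat \<Rightarrow> real) \<Rightarrow> real"

definition pd :: "nat \<Rightarrow> jet_fun \<Rightarrow> jet_fun" where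
  "pd i F v = deriv (\<lambda>s. F (v(i := s))) (v i)"

text \<open>Continuity refers to the product topology; for functions of finitely many coordinates it is
  joint continuity in these.\<close>
primrec Ck_jet :: "nat \<Rightarrow> jet_fun \<Rightarrow> bool" where
  "Ck_jet 0 F \<longleftrightarrow> continuous_on UNIV F"
| "Ck_jet (Suc n) F \<longleftrightarrow> continuous_on UNIV F \<and>
     (\<forall>i v. (\<lambda>s. F (v(i := s))) field_differentiable (at (v i))) \<and>
     (\<forall>i. Ck_jet n (pd i F))"

definition local_fun :: "jet_fun \<Rightarrow> bool" where
  "local_fun F \<longleftrightarrow>
     (\<exists>n. \<forall>v w. (\<forall>i\<le>n. v i = w i) \<longrightarrow> F v = F w) \<and> (\<forall>n. Ck_jet n F)"

text \<open>The total derivative. For a local function only finitely many partial derivatives are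
  not identically zero, so the index set is finite.\<close>
definition D :: "jet_fun \<Rightarrow> jet_fun" where
  "D F v = (\<Sum>i | pd i F v \<noteq> 0. v (Suc i) * pd i F v)"

text \<open>Evaluation $F[u]$ along a function \<open>u\<close>.\<close>
definition ev :: "jet_fun \<Rightarrow> (real \<Rightarrow> real) \<Rightarrow> real \<Rightarrow> real" where
  "ev F u x = F (\<lambda>n. (deriv ^^ n) u x)"

section \<open>The Kaup-Kuperschmidt hierarchy\<close>

definition KK0 :: jet_fun where
  "KK0 v = v 1"

definition KK1 :: jet_fun where
  "KK1 v = v 5 + 5 * v 0 * v 3 + 25/2 * v 1 * v 2 + 5 * (v 0)\<^sup>2 * v 1"

text \<open>The recursion operator applied to \<open>K\<close>, where \<open>L\<close> and \<open>M\<close> are the values used for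
  $D^{-1}K$ and $D^{-1}((u''+2u^2)K)$.\<close>
definition KK_rec :: "jet_fun \<Rightarrow> jet_fun \<Rightarrow> jet_fun \<Rightarrow> jet_fun" where
  "KK_rec K L M v =
     (D ^^ 6) K v + 6 * v 0 * (D ^^ 4) K v + 18 * v 1 * (D ^^ 3) K v
     + (9 * (v 0)\<^sup>2 + 49/2 * v 2) * (D ^^ 2) K v
     + (30 * v 1 * v 0 + 35/2 * v 3) * D K v
     + (13/2 * v 4 + 41/2 * v 2 * v 0 + 69/4 * (v 1)\<^sup>2 + 4 * (v 0) ^ 3) * K v
     + KK1 v * L v + 1/2 * v 1 * M v"

fun KK :: "(nat \<Rightarrow> jet_fun) \<Rightarrow> (nat \<Rightarrow> jet_fun) \<Rightarrow> nat \<Rightarrow> jet_fun" where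
  "KK L M 0 = KK0"
| "KK L M (Suc 0) = KK1"
| "KK L M (Suc (Suc j)) = KK_rec (KK L M j) (L j) (M j)"

text \<open>The antiderivatives \<open>L j\<close> and \<open>M j\<close> are determined only up to additive constants, and the
  later members of the hierarchy depend on these constants; every choice is admitted.\<close>
definition KK_antiderivatives :: "(nat \<Rightarrow> jet_fun) \<Rightarrow> (nat \<Rightarrow> jet_fun) \<Rightarrow> bool" where
  "KK_antiderivatives L M \<longleftrightarrow>
     (\<forall>j. local_fun (L j) \<and> local_fun (M j) \<and>
          D (L j) = KK L M j \<and>
          D (M j) = (\<lambda>v. (v 2 + 2 * (v 0)\<^sup>2) * KK L M j v))"

definition flow_coeff :: "jet_fun \<Rightarrow> jet_fun \<Rightarrow> jet_fun" where
  "flow_coeff L M v =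
     1/18 * (M v + ((D ^^ 4) L v + 5 * v 0 * (D ^^ 2) L v + 5/2 * v 1 * D L v
                    + (v 2 + 2 * (v 0)\<^sup>2) * L v))"

end

theory Submission
  imports Defs
begin

text \<open>In a normalized framing $\langle\Gamma_{xx},\Gamma_{xx}\rangle = -2k = u$. Hence $u$ is smooth, and
  since mixed partial derivatives commute,
  $u_t = 2\,\mathrm{Re}\,\langle\partial_x^2\Gamma_t,\Gamma_{xx}\rangle$.
  Differentiating the evolution equation twice with the frame equations gives
  $u_t = 2a''' + 2ua' + u'a - 3h'$. Here $h' = K_j$, and with $18a = S$ the
  recursion operator factors as $K_{j+2} = S''' + uS' + \frac12 u'S$.\<close>

section \<open>Calculus on jet space\<close>

text \<open>The framing condition holds at each time separately, so it gives no information on how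
  \<open>T\<close>, \<open>N\<close> and \<open>k\<close> depend on time; joint smoothness is
  available only for \<open>\<Gamma>\<close>. Whatever is differentiated in time is therefore first
  rewritten through x-derivatives of \<open>\<Gamma>\<close>, and for u a single Hermitian square is
  enough. A second obstacle is that \<open>D\<close> is built from coordinatewise partial
  derivatives on jet space, so the relations between L_j, M_j and K_j say something about functions
  of x only after a chain rule for jets is available. The factorization also explains the shape of
  a. Since D M_j = (u'' + 2u^2) D L_j, differentiating S makes the M_j part local, and in S''' + u
  S' + u' S / 2 only the last summand retains M_j; it is the last term of the recursion operator,
  while the undifferentiated L_j collects the factor K_1. The same L_j and M_j enter a and K_{j+2},
  so every choice of integration constants is carried along consistently. The outer operator D^3 + u
  D + u'/2 is, up to scaling of u, the second Hamiltonian operator of KdV.\<close>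

definition jet_order_le :: "nat \<Rightarrow> jet_fun \<Rightarrow> bool" where
  "jet_order_le n F \<longleftrightarrow> (\<forall>v w. (\<forall>i\<le>n. v i = w i) \<longrightarrow> F v = F w)"

lemma jet_order_leD:
  assumes "jet_order_le n F" "\<And>i. i \<le> n \<Longrightarrow> v i = w i"
  shows "F v = F w"
  using assms by (auto simp: jet_order_le_def)

lemma Ck_jet_Suc_imp: "Ck_jet (Suc n) F \<Longrightarrow> Ck_jet n F"
  by (induction n arbitrary: F) auto

lemma Ck_jet_pd: "Ck_jet (Suc n) F \<Longrightarrow> Ck_jet n (pd i F)"
  by simp

text \<open>\<open>Ck_jet\<close> speaks only of the derivative at the current coordinate
  \<open>v i\<close>; applying it to the updated sequence gives every point \<open>r\<close>. The
  chain rule needs this freedom because it differentiates at points off the curve.\<close>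

lemma DERIV_pd:
  assumes "Ck_jet (Suc n) F"
  shows "((\<lambda>s. F (v(i := s))) has_real_derivative pd i F (v(i := r))) (at r)"
proof -
  have "(\<lambda>s. F ((v(i := r))(i := s))) field_differentiable (at ((v(i := r)) i))"
    using assms unfolding Ck_jet.simps by blast
  then show ?thesis
    by (simp add: DERIV_deriv_iff_field_differentiable[symmetric] pd_def)
qed

lemma pd_eqI:
  assumes "\<And>v. ((\<lambda>s. F (v(i := s))) has_real_derivative G v) (at (v i))"
  shows "pd i F = G"
  using assms by (intro ext) (simp add: pd_def DERIV_imp_deriv)

lemma DERIV_pd_at:
  assumes "Ck_jet (Suc n) F"
  shows "((\<lambda>s. F (v(i := s))) has_real_derivative pd i F v) (at (v i))"
  using DERIV_pd[OF assms, of v i "v i"] by simp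

lemma Ck_jet_const: "Ck_jet n (\<lambda>v. c)"
proof (induction n arbitrary: c)
  case (Suc n)
  have "pd i (\<lambda>v. c) = (\<lambda>v. 0)" for i
    by (rule pd_eqI) simp
  with Suc show ?case by simp
qed simp

lemma Ck_jet_coord: "Ck_jet n (\<lambda>v. v m)"
proof (cases n)
  case (Suc k)
  have d: "((\<lambda>s. (v(i := s)) m) has_real_derivative (if i = m then 1 else 0)) (at (v i))" for v i
    by (auto intro!: derivative_eq_intros)
  have "pd i (\<lambda>v. v m) = (\<lambda>v. if i = m then 1 else 0)" for i
    by (rule pd_eqI) (rule d)
  then show ?thesis
    using d by (auto simp: Suc Ck_jet_const field_differentiable_def)
qed simp

lemma Ck_jet_add:
  assumes "Ck_jet n F" "Ck_jet n G"
  shows "Ck_jet n (\<lambda>v. F v + G v)"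
  using assms
proof (induction n arbitrary: F G)
  case (Suc n)
  have d: "((\<lambda>s. F (v(i := s)) + G (v(i := s))) has_real_derivative (pd i F v + pd i G v)) (at (v i))"
    for v i
    by (intro DERIV_add DERIV_pd_at[OF Suc.prems(1)] DERIV_pd_at[OF Suc.prems(2)])
  have "pd i (\<lambda>v. F v + G v) = (\<lambda>v. pd i F v + pd i G v)" for i
    by (rule pd_eqI) (rule d)
  with d Suc show ?case
    by (auto simp: field_differentiable_def intro!: continuous_on_add)
qed (auto intro: continuous_on_add)

lemma Ck_jet_mult:
  assumes "Ck_jet n F" "Ck_jet n G"
  shows "Ck_jet n (\<lambda>v. F v * G v)"
  using assms
proof (induction n arbitrary: F G)
  case (Suc n)
  have d: "((\<lambda>s. F (v(i := s)) * G (v(i := s))) has_real_derivative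
      (pd i F v * G v + pd i G v * F v)) (at (v i))" for v i
    using DERIV_mult[OF DERIV_pd_at[OF Suc.prems(1), of v i] DERIV_pd_at[OF Suc.prems(2), of v i]]
    by (simp only: fun_upd_triv)
  have "pd i (\<lambda>v. F v * G v) = (\<lambda>v. pd i F v * G v + pd i G v * F v)" for i
    by (rule pd_eqI) (rule d)
  moreover have "Ck_jet n (\<lambda>v. pd i F v * G v + pd i G v * F v)" for i
    using Suc.prems Ck_jet_Suc_imp by (intro Ck_jet_add Suc.IH) auto
  moreover have "(\<lambda>s. F (v(i := s)) * G (v(i := s))) field_differentiable at (v i)" for i v
    using d unfolding field_differentiable_def by blast
  ultimately show ?case
    using Suc.prems by (simp add: continuous_on_mult)
qed (auto intro: continuous_on_mult)

lemma Ck_jet_sum: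
  assumes "\<And>i. i \<in> A \<Longrightarrow> Ck_jet n (F i)"
  shows "Ck_jet n (\<lambda>v. \<Sum>i\<in>A. F i v)"
  using assms by (induction A rule: infinite_finite_induct) (auto simp: Ck_jet_const Ck_jet_add)

lemma pd_eq_0_above_order:
  assumes "jet_order_le n F" "n < i"
  shows "pd i F v = 0"
proof -
  have "(\<lambda>s. F (v(i := s))) = (\<lambda>s. F v)"
    using assms(2) by (intro ext jet_order_leD[OF assms(1)]) auto
  then show ?thesis by (simp add: pd_def)
qed

text \<open>The index set in \<open>D\<close> varies with \<open>v\<close>. A bound on the order
  replaces it by a fixed one, so that \<open>D F\<close> becomes a sum of products to which the
  closure properties of \<open>Ck_jet\<close> apply.\<close>

lemma D_eq_sum_atMost:
  assumes "jet_order_le n F"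
  shows "D F v = (\<Sum>i\<le>n. v (Suc i) * pd i F v)"
  unfolding D_def
  using pd_eq_0_above_order[OF assms, of _ v]
  by (intro sum.mono_neutral_left) (auto simp: not_less[symmetric])

lemma jet_order_le_pd:
  assumes "jet_order_le n F"
  shows "jet_order_le n (pd i F)"
proof (cases "i \<le> n")
  case True
  have "pd i F v = pd i F w" if vw: "\<forall>i\<le>n. v i = w i" for v w
  proof -
    have "(\<lambda>s. F (v(i := s))) = (\<lambda>s. F (w(i := s)))"
      using vw by (intro ext jet_order_leD[OF assms]) auto
    with True vw show ?thesis by (simp add: pd_def)
  qed
  then show ?thesis by (simp add: jet_order_le_def)
next
  case False
  then show ?thesis
    using pd_eq_0_above_order[OF assms] by (simp add: jet_order_le_def)
qed

lemma local_fun_D: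
  assumes "local_fun F"
  shows "local_fun (D F)"
proof -
  obtain n where n: "jet_order_le n F" and ck: "\<And>m. Ck_jet m F"
    using assms by (auto simp: local_fun_def jet_order_le_def)
  have eq: "D F = (\<lambda>v. \<Sum>i\<le>n. v (Suc i) * pd i F v)"
    by (intro ext D_eq_sum_atMost n)
  have "D F v = D F w" if vw: "\<forall>i\<le>Suc n. v i = w i" for v w
  proof -
    have "pd i F v = pd i F w" for i
      using vw by (intro jet_order_leD[OF jet_order_le_pd[OF n]]) auto
    then show ?thesis
      using vw by (auto simp: eq intro!: sum.cong)
  qed
  moreover have "Ck_jet m (D F)" for m
    unfolding eq by (intro Ck_jet_sum Ck_jet_mult Ck_jet_coord Ck_jet_pd ck)
  ultimately show ?thesis
    unfolding local_fun_def by blast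
qed

lemma local_fun_D_funpow: "local_fun F \<Longrightarrow> local_fun ((D ^^ m) F)"
  by (induction m) (auto intro: local_fun_D)

lemma isCont_coordinatewise:
  fixes f :: "'a::t2_space \<Rightarrow> 'i \<Rightarrow> 'b::topological_space"
  assumes "\<And>i. isCont (\<lambda>x. f x i) x"
  shows "isCont f x"
proof -
  have "limitin (product_topology (\<lambda>i. euclidean) UNIV) f (f x) (at x)"
    using assms by (simp add: limitin_componentwise isCont_def)
  then show ?thesis
    by (simp add: euclidean_product_topology isCont_def)
qed

text \<open>The coordinates of the curve are switched on one at a time, so that each step is the chain
  rule for a function of two variables.\<close>
lemma jet_chain_rule:
  fixes c :: "real \<Rightarrow> nat \<Rightarrow> real"
  assumes F: "jet_order_le n F" "Ck_jet 1 F"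
    and c: "\<And>i. ((\<lambda>s. c s i) has_real_derivative c' i) (at x)"
  shows "((\<lambda>s. F (c s)) has_real_derivative (\<Sum>i\<le>n. c' i * pd i F (c x))) (at x)"
proof -
  \<comment> \<open>In \<open>P m s\<close> the coordinates below \<open>m\<close> move with
    \<open>s\<close>, and the others stay frozen at their values at \<open>x\<close>.\<close>
  define P where "P m s = (\<lambda>i. if i < m then c s i else c x i)" for m s
  have *: "((\<lambda>s. F (P m s)) has_real_derivative (\<Sum>i<m. c' i * pd i F (c x))) (at x)" for m
  proof (induction m)
    case 0
    show ?case by (simp add: P_def)
  next
    case (Suc m)
    define f where "f s r = F ((P m s)(m := r))" for s r
    \<comment> \<open>The partial derivative is packaged as a bounded linear map, since the
      criterion for total differentiability asks for its continuity in operator norm.\<close>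
    define fy where "fy s r = blinfun_mult_right (pd m F ((P m s)(m := r)))" for s r
    have Pupd: "(P m s)(m := c x m) = P m s" for s
      by (auto simp: P_def)
    have Px: "P m x = c x"
      by (auto simp: P_def)
    have fx: "((\<lambda>s. f s (c x m)) has_derivative (*) (\<Sum>i<m. c' i * pd i F (c x))) (at x within UNIV)"
      using Suc.IH by (simp add: f_def Pupd has_field_derivative_def)
    have fy: "((\<lambda>r. f s r) has_derivative blinfun_apply (fy s r)) (at r within UNIV)" for s r
      using DERIV_pd[of 0 F "P m s" m r] F(2)
      by (simp add: f_def fy_def has_field_derivative_def)
    \<comment> \<open>Jets carry the product topology, so continuity of the moving point can be
      checked one coordinate at a time.\<close>
    have coord: "isCont (\<lambda>p. ((P m (fst p))(m := snd p)) i) (x, c x m)" for i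
    proof -
      have "isCont (\<lambda>s. c s i) (fst (x, c x m))"
        using c[of i] by (auto intro: DERIV_isCont)
      then have "isCont (\<lambda>p. c (fst p) i) (x, c x m)"
        by (rule isCont_o2[OF isCont_fst[OF continuous_ident]])
      then show ?thesis
        by (cases "i = m"; cases "i < m") (auto simp: P_def intro!: continuous_intros)
    qed
    have pdc: "continuous_on UNIV (pd m F)"
      using F(2) by simp
    have "isCont (\<lambda>p. pd m F ((P m (fst p))(m := snd p))) (x, c x m)"
      using pdc by (intro isCont_o2[OF isCont_coordinatewise[OF coord]])
        (simp add: continuous_on_eq_continuous_at)
    then have "isCont (\<lambda>p. fy (fst p) (snd p)) (x, c x m)"
      unfolding fy_def by (intro bounded_linear.isCont[OF bounded_linear_blinfun_mult_right])
    then have cont: "continuous (at (x, c x m) within UNIV \<times> UNIV) (\<lambda>(s, r). fy s r)"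
      by (simp add: case_prod_unfold)
    have "((\<lambda>(s, r). f s r) has_derivative
        (\<lambda>(ts, tr). (\<Sum>i<m. c' i * pd i F (c x)) * ts + fy x (c x m) tr)) (at (x, c x m) within UNIV \<times> UNIV)"
      using fx fy cont by (rule has_derivative_partialsI) auto
    then have f: "((\<lambda>(s, r). f s r) has_derivative
        (\<lambda>(ts, tr). (\<Sum>i<m. c' i * pd i F (c x)) * ts + fy x (c x m) tr)) (at (x, c x m))"
      by simp
    have "((\<lambda>s. (s, c s m)) has_derivative (\<lambda>h. (h, c' m * h))) (at x)"
      using c[of m] by (auto intro!: derivative_eq_intros simp: has_field_derivative_def)
    from has_derivative_compose[OF this f] have "((\<lambda>s. f s (c s m)) has_derivative
        (\<lambda>h. (\<Sum>i<m. c' i * pd i F (c x)) * h + fy x (c x m) (c' m * h))) (at x)"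
      by (simp add: case_prod_unfold)
    moreover have "f s (c s m) = F (P (Suc m) s)" for s
      by (auto simp: f_def P_def less_Suc_eq fun_eq_iff intro!: arg_cong[where f = F])
    ultimately show ?case
      by (auto intro!: has_derivative_imp_has_field_derivative
        simp: fy_def Px algebra_simps fun_upd_idem)
  qed
  \<comment> \<open>After \<open>Suc n\<close> switches the coordinates 0 to \<open>n\<close> all
    move, and these are the only ones that \<open>F\<close> sees.\<close>
  have "F (P (Suc n) s) = F (c s)" for s
    by (rule jet_order_leD[OF F(1)]) (auto simp: P_def)
  with *[of "Suc n"] show ?thesis
    by (simp add: lessThan_Suc_atMost)
qed

text \<open>The velocity of the jet curve of \<open>u\<close> is the jet shifted by one place, so
  the chain rule sum is exactly the one defining \<open>D F\<close>.\<close>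

lemma DERIV_ev:
  assumes F: "local_fun F"
    and u: "\<And>m. (deriv ^^ m) u field_differentiable at x"
  shows "(ev F u has_real_derivative ev (D F) u x) (at x)"
proof -
  obtain n where n: "jet_order_le n F" and ck: "\<And>m. Ck_jet m F"
    using F by (auto simp: local_fun_def jet_order_le_def)
  have "((\<lambda>s. F (\<lambda>m. (deriv ^^ m) u s)) has_real_derivative
      (\<Sum>i\<le>n. (deriv ^^ Suc i) u x * pd i F (\<lambda>m. (deriv ^^ m) u x))) (at x)"
    using u by (intro jet_chain_rule[OF n ck]) (simp add: DERIV_deriv_iff_field_differentiable)
  moreover have "ev F u = (\<lambda>s. F (\<lambda>m. (deriv ^^ m) u s))"
    by (simp add: ev_def fun_eq_iff)
  ultimately show ?thesis
    by (simp add: ev_def D_eq_sum_atMost[OF n])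
qed

section \<open>Smooth maps of two real variables\<close>

definition pdir :: "'a::real_normed_vector \<Rightarrow> ('a \<Rightarrow> 'b::real_normed_vector) \<Rightarrow> 'a \<Rightarrow> 'b" where
  "pdir v f p = frechet_derivative f (at p) v"

lemma Ck_on_Suc: "Ck_on (Suc n) S f \<longleftrightarrow> (\<forall>p\<in>S. f differentiable (at p)) \<and> (\<forall>v. Ck_on n S (pdir v f))"
  unfolding Ck_on.simps pdir_def ..

lemma pdir_eqI: "(f has_derivative f') (at p) \<Longrightarrow> pdir v f p = f' v"
  by (metis frechet_derivative_at pdir_def)

lemma pdir_cong:
  assumes "open S" "\<And>p. p \<in> S \<Longrightarrow> f p = g p" "\<And>p. p \<in> S \<Longrightarrow> f differentiable (at p)" "p \<in> S"
  shows "pdir v f p = pdir v g p"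
  unfolding pdir_def using assms by (metis frechet_derivative_transform_within_open)

text \<open>A Frechet derivative on an open set depends only on the values there, so agreement on
  \<open>S\<close> passes to all iterated derivatives, whatever the maps do outside
  \<open>S\<close>.\<close>

lemma Ck_on_cong:
  assumes "open S" "\<And>p. p \<in> S \<Longrightarrow> f p = g p" "Ck_on n S f"
  shows "Ck_on n S g"
  using assms(2,3)
proof (induction n arbitrary: f g)
  case 0
  then show ?case
    by (simp cong: continuous_on_cong_simp)
next
  case (Suc n)
  have f: "f differentiable (at p)" if "p \<in> S" for p
    using Suc.prems(2) that by simp
  have "g differentiable (at p)" if "p \<in> S" for p
    using f[OF that] has_derivative_transform_within_open[of f _ p UNIV S g] assms(1) that Suc.prems(1)
    unfolding differentiable_def by blast
  moreover have "Ck_on n S (pdir v g)" for v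
    using Suc.prems(2) pdir_cong[OF assms(1) Suc.prems(1) f]
    by (intro Suc.IH[of "pdir v f" "pdir v g"]) (auto simp: Ck_on_Suc simp del: Ck_on.simps)
  ultimately show ?case
    by (simp add: Ck_on_Suc del: Ck_on.simps)
qed

lemma Ck_on_Suc_imp: "Ck_on (Suc n) S f \<Longrightarrow> Ck_on n S f"
proof (induction n arbitrary: f)
  case 0
  then show ?case
    by (auto intro!: continuous_at_imp_continuous_on differentiable_imp_continuous_within)
next
  case (Suc n)
  have "Ck_on n S (pdir v f)" for v
    using Suc.prems unfolding Ck_on_Suc[of "Suc n"] by (intro Suc.IH) blast
  then show ?case
    using Suc.prems by (simp add: Ck_on_Suc del: Ck_on.simps)
qed

lemma Ck_on_SucI:
  assumes "open S" "\<And>p. p \<in> S \<Longrightarrow> (f has_derivative f' p) (at p)" "\<And>v. Ck_on n S (\<lambda>p. f' p v)"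
  shows "Ck_on (Suc n) S f"
  unfolding Ck_on_Suc
proof (intro conjI ballI allI)
  show "f differentiable (at p)" if "p \<in> S" for p
    using assms(2)[OF that] by (auto simp: differentiable_def)
  show "Ck_on n S (pdir v f)" for v
    using assms(1) _ assms(3)[of v] by (rule Ck_on_cong) (simp add: pdir_eqI[OF assms(2)])
qed

lemma Ck_on_has_derivative:
  assumes "Ck_on (Suc n) S f" "p \<in> S"
  shows "(f has_derivative (\<lambda>v. pdir v f p)) (at p)"
  using assms by (simp add: frechet_derivative_works[symmetric] pdir_def)

lemma Ck_on_pdir: "Ck_on (Suc n) S f \<Longrightarrow> Ck_on n S (pdir v f)"
  unfolding Ck_on_Suc by blast

lemma Ck_on_add:
  assumes "open S" "Ck_on n S f" "Ck_on n S g"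
  shows "Ck_on n S (\<lambda>p. f p + g p)"
  using assms(2,3)
proof (induction n arbitrary: f g)
  case (Suc n)
  show ?case
  proof (rule Ck_on_SucI[OF assms(1)])
    show "((\<lambda>p. f p + g p) has_derivative (\<lambda>v. pdir v f p + pdir v g p)) (at p)" if "p \<in> S" for p
      using Suc.prems that by (intro has_derivative_add Ck_on_has_derivative)
    show "Ck_on n S (\<lambda>p. pdir v f p + pdir v g p)" for v
      using Suc.prems by (intro Suc.IH Ck_on_pdir)
  qed
qed (auto intro: continuous_on_add)

text \<open>By the product rule the derivative is a sum of two products of the same kind with one
  order of smoothness less. Here \<open>prod\<close> is the bilinear map of the locale; the instance
  needed is the real part of \<open>herm\<close>.\<close>

lemma (in bounded_bilinear) Ck_on:
  assumes "open S" "Ck_on n S f" "Ck_on n S g"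
  shows "Ck_on n S (\<lambda>p. prod (f p) (g p))"
  using assms(2,3)
proof (induction n arbitrary: f g)
  case 0
  then show ?case by (simp add: continuous_on)
next
  case (Suc n)
  show ?case
  proof (rule Ck_on_SucI[OF assms(1)])
    show "((\<lambda>p. prod (f p) (g p)) has_derivative
        (\<lambda>v. prod (f p) (pdir v g p) + prod (pdir v f p) (g p))) (at p)" if "p \<in> S" for p
      using Suc.prems that by (intro FDERIV Ck_on_has_derivative)
    show "Ck_on n S (\<lambda>p. prod (f p) (pdir v g p) + prod (pdir v f p) (g p))" for v
      by (intro Ck_on_add assms(1) Suc.IH Suc.prems[THEN Ck_on_pdir] Suc.prems[THEN Ck_on_Suc_imp])
  qed
qed

lemma (in bounded_bilinear) smooth_on:
  "open S \<Longrightarrow> smooth_on S f \<Longrightarrow> smooth_on S g \<Longrightarrow> smooth_on S (\<lambda>p. prod (f p) (g p))"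
  by (simp add: smooth_on_def Ck_on)

lemma smooth_on_pdir: "smooth_on S f \<Longrightarrow> smooth_on S (pdir v f)"
  unfolding smooth_on_def using Ck_on_pdir by blast

lemma smooth_on_has_derivative:
  "smooth_on S f \<Longrightarrow> p \<in> S \<Longrightarrow> (f has_derivative (\<lambda>v. pdir v f p)) (at p)"
  unfolding smooth_on_def using Ck_on_has_derivative by blast

lemma smooth_on_imp_continuous_on: "smooth_on S f \<Longrightarrow> continuous_on S f"
  unfolding smooth_on_def using Ck_on.simps(1) by blast

lemma has_vector_derivative_pdir:
  assumes "(f has_derivative (\<lambda>v. pdir v f (c x))) (at (c x))" "(c has_vector_derivative w) (at x)"
  shows "((\<lambda>s. f (c s)) has_vector_derivative pdir w f (c x)) (at x)"
proof -
  interpret f': bounded_linear "\<lambda>v. pdir v f (c x)"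
    using assms(1) by (rule has_derivative_bounded_linear)
  show ?thesis
    using has_derivative_compose[OF assms(2)[unfolded has_vector_derivative_def] assms(1)]
    by (simp add: has_vector_derivative_def f'.scaleR)
qed

lemma smooth_on_has_partial_fst:
  fixes f :: "real \<times> real \<Rightarrow> 'b::real_normed_vector"
  assumes "smooth_on S f" "(t, x) \<in> S"
  shows "((\<lambda>s. f (s, x)) has_vector_derivative pdir (1, 0) f (t, x)) (at t)"
  using smooth_on_has_derivative[OF assms]
  by (rule has_vector_derivative_pdir[where c = "\<lambda>s. (s, x)"]) (intro derivative_intros)

lemma smooth_on_has_partial_snd:
  fixes f :: "real \<times> real \<Rightarrow> 'b::real_normed_vector"
  assumes "smooth_on S f" "(t, x) \<in> S"
  shows "((\<lambda>y. f (t, y)) has_vector_derivative pdir (0, 1) f (t, x)) (at x)"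
  using smooth_on_has_derivative[OF assms]
  by (rule has_vector_derivative_pdir[where c = "\<lambda>y. (t, y)"]) (intro derivative_intros)

text \<open>Differentiate \<open>f (s, y) = f (s, c) + \<integral> pdir (0, 1) f (s, z) dz\<close> with respect to \<open>s\<close> under the
  integral sign, and the result with respect to \<open>y\<close>.\<close>
lemma pdir_commute:
  fixes f :: "real \<times> real \<Rightarrow> 'b::banach"
  assumes S: "open S" and f: "smooth_on S f" and tx: "(t, x) \<in> S"
  shows "pdir (1, 0) (pdir (0, 1) f) (t, x) = pdir (0, 1) (pdir (1, 0) f) (t, x)"
proof -
  let ?X = "pdir (0, 1) f" and ?XT = "pdir (1, 0) (pdir (0, 1) f)"
  obtain A B where AB: "open A" "open B" "(t, x) \<in> A \<times> B" "A \<times> B \<subseteq> S"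
    using open_prod_elim[OF S tx] by metis
  obtain d where d: "d > 0" "ball t d \<subseteq> A"
    using AB(1,3) by (auto simp: open_contains_ball)
  obtain e where e: "e > 0" "cball x e \<subseteq> B"
    using AB(2,3) by (auto simp: open_contains_cball)
  \<comment> \<open>The base point \<open>c\<close> of the integration lies strictly left of
    \<open>x\<close> and \<open>b\<close> strictly right of it, so the derivative within the closed
    interval is a genuine derivative at \<open>x\<close>.\<close>
  define c b where "c = x - e" and "b = x + e"
  have cb: "{c..b} \<subseteq> B"
    using e(2) by (auto simp: c_def b_def cball_eq_atLeastAtMost)
  have xcb: "x \<in> {c<..<b}"
    using e(1) by (auto simp: c_def b_def)
  have in_S: "(s, y) \<in> S" if "s \<in> ball t d" "y \<in> {c..b}" for s y
    using that AB(4) d(2) cb by blast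
  have t: "t \<in> ball t d"
    using d(1) by simp
  have X: "smooth_on S ?X" and T: "smooth_on S (pdir (1, 0) f)"
    by (intro smooth_on_pdir f)+
  have XT: "smooth_on S ?XT"
    by (intro smooth_on_pdir X)
  have cont: "continuous_on {c..b} (\<lambda>y. g (s, y))"
    if "smooth_on S g" "s \<in> ball t d" for g :: "real \<times> real \<Rightarrow> 'b" and s
    using in_S that(2)
    by (intro continuous_on_compose2[OF smooth_on_imp_continuous_on[OF that(1)]])
      (auto intro!: continuous_intros)
  have ftc: "integral {c..y} (\<lambda>z. ?X (s, z)) = f (s, y) - f (s, c)"
    if "s \<in> ball t d" "y \<in> {c..b}" for s y
    using that in_S
    by (intro integral_unique fundamental_theorem_of_calculus)
      (auto intro!: has_vector_derivative_at_within smooth_on_has_partial_snd[OF f])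
  have dT: "pdir (1, 0) f (t, y) = pdir (1, 0) f (t, c) + integral {c..y} (\<lambda>z. ?XT (t, z))"
    if y: "y \<in> {c..b}" for y
  proof -
    have sub: "cbox c y \<subseteq> {c..b}"
      using y by simp
    have box: "ball t d \<times> cbox c y \<subseteq> S"
      using in_S sub by blast
    have "((\<lambda>s. integral (cbox c y) (\<lambda>z. ?X (s, z))) has_vector_derivative
        integral (cbox c y) (\<lambda>z. ?XT (t, z))) (at t within ball t d)"
    proof (rule leibniz_rule_vector_derivative)
      show "((\<lambda>s. ?X (s, z)) has_vector_derivative ?XT (s, z)) (at s within ball t d)"
        if "s \<in> ball t d" "z \<in> cbox c y" for s z
      proof (rule has_vector_derivative_at_within[OF smooth_on_has_partial_fst[OF X]])
        show "(s, z) \<in> S"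
          using that box by blast
      qed
      show "(\<lambda>z. ?X (s, z)) integrable_on cbox c y" if "s \<in> ball t d" for s
        by (rule integrable_continuous[OF continuous_on_subset[OF cont[OF X that] sub]])
      show "continuous_on (ball t d \<times> cbox c y) (\<lambda>(s, z). ?XT (s, z))"
        using continuous_on_subset[OF smooth_on_imp_continuous_on[OF XT] box]
        by (simp add: case_prod_unfold)
      show "t \<in> ball t d" "convex (ball t d)"
        using t by simp_all
    qed
    then have "((\<lambda>s. integral {c..y} (\<lambda>z. ?X (s, z))) has_vector_derivative
        integral {c..y} (\<lambda>z. ?XT (t, z))) (at t)"
      unfolding at_within_open[OF t open_ball] by simp
    then have "((\<lambda>s. f (s, y) - f (s, c)) has_vector_derivative integral {c..y} (\<lambda>z. ?XT (t, z))) (at t)"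
      by (rule has_vector_derivative_transform_within_open[OF _ open_ball t]) (rule ftc[OF _ y])
    moreover have "((\<lambda>s. f (s, y) - f (s, c)) has_vector_derivative
        (pdir (1, 0) f (t, y) - pdir (1, 0) f (t, c))) (at t)"
      by (intro has_vector_derivative_diff smooth_on_has_partial_fst[OF f] in_S[OF t])
        (use y xcb in simp_all)
    ultimately have "integral {c..y} (\<lambda>z. ?XT (t, z)) = pdir (1, 0) f (t, y) - pdir (1, 0) f (t, c)"
      by (rule vector_derivative_unique_at)
    then show ?thesis
      by (simp add: algebra_simps)
  qed
  have "((\<lambda>y. integral {c..y} (\<lambda>z. ?XT (t, z))) has_vector_derivative ?XT (t, x)) (at x within {c..b})"
    using xcb by (intro integral_has_vector_derivative cont XT t) auto
  then have "((\<lambda>y. integral {c..y} (\<lambda>z. ?XT (t, z))) has_vector_derivative ?XT (t, x)) (at x)"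
    using xcb by (simp add: at_within_Icc_at)
  then have "((\<lambda>y. pdir (1, 0) f (t, c) + integral {c..y} (\<lambda>z. ?XT (t, z)))
      has_vector_derivative (0 + ?XT (t, x))) (at x)"
    by (intro has_vector_derivative_add has_vector_derivative_const)
  then have "((\<lambda>y. pdir (1, 0) f (t, y)) has_vector_derivative (0 + ?XT (t, x))) (at x)"
    by (rule has_vector_derivative_transform_within_open[OF _ open_greaterThanLessThan xcb])
      (simp add: dT[symmetric])
  then show ?thesis
    using vector_derivative_unique_at smooth_on_has_partial_snd[OF T tx] by fastforce
qed

text \<open>\<open>ev\<close> uses the iterated \<open>deriv\<close> of a function that is known to
  be a slice of a smooth map only on \<open>I\<close>. Openness of \<open>I\<close> carries the
  agreement through each further derivative.\<close>

lemma funpow_deriv_slice: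
  fixes f :: "real \<times> real \<Rightarrow> real"
  assumes "open I" "smooth_on (J \<times> I) f" "t \<in> J" "x \<in> I" "\<And>y. y \<in> I \<Longrightarrow> g y = f (t, y)"
  shows "((deriv ^^ n) g has_real_derivative (deriv ^^ Suc n) g x) (at x)"
proof -
  have sm: "smooth_on (J \<times> I) ((pdir (0, 1) ^^ n) f)" for n
    by (induction n) (auto intro: smooth_on_pdir assms)
  \<comment> \<open>Agreement is required on all of \<open>I\<close>, not just at the point: the
    induction for \<open>eq\<close> has to transfer a derivative.\<close>
  have d: "((deriv ^^ n) g has_real_derivative (pdir (0, 1) ^^ Suc n) f (t, x)) (at x)"
    if "\<And>y. y \<in> I \<Longrightarrow> (deriv ^^ n) g y = (pdir (0, 1) ^^ n) f (t, y)" "x \<in> I" for n x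
    using has_vector_derivative_transform_within_open[OF _ assms(1) that(2) that(1)[symmetric]]
      smooth_on_has_partial_snd[OF sm[of n], of t x] assms(3) that(2)
    by (simp add: has_real_derivative_iff_has_vector_derivative)
  have eq: "(deriv ^^ n) g x = (pdir (0, 1) ^^ n) f (t, x)" if "x \<in> I" for n x
    using that
  proof (induction n arbitrary: x)
    case (Suc n)
    then show ?case using DERIV_imp_deriv[OF d] by simp
  qed (simp add: assms)
  show "((deriv ^^ n) g has_real_derivative (deriv ^^ Suc n) g x) (at x)"
    unfolding eq[OF assms(4)] by (intro d eq assms)
qed

section \<open>Frame fields and their evolution\<close>

text \<open>Sesquilinear over the complex numbers is bilinear over the reals, which is what the
  product rule in a real parameter needs.\<close>

lemma bounded_bilinear_herm: "bounded_bilinear herm"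
  unfolding bilinear_conv_bounded_bilinear[symmetric] bilinear_def
  by (auto simp: linear_iff herm_def algebra_simps scaleR_conv_of_real[where 'a = complex])

lemma bounded_bilinear_vector_scalar_mult:
  "bounded_bilinear ((*s) :: complex \<Rightarrow> complex ^ 'n \<Rightarrow> complex ^ 'n)"
  unfolding bilinear_conv_bounded_bilinear[symmetric] bilinear_def
  by (auto simp: linear_iff vec_eq_iff algebra_simps scaleR_conv_of_real[where 'a = complex])

lemma herm_cnj: "herm w z = cnj (herm z w)"
  by (simp add: herm_def mult.commute)

lemma herm_add_left: "herm (v + w) z = herm v z + herm w z"
  and herm_add_right: "herm z (v + w) = herm z v + herm z w"
  and herm_smult_left: "herm (c *s v) z = c * herm v z"
  and herm_smult_right: "herm z (c *s v) = cnj c * herm z v"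
  by (simp_all add: herm_def algebra_simps)

lemma null_frame_herm:
  assumes "null_frame e0 e1 e2"
  shows "herm e0 e0 = 0" "herm e0 e1 = 0" "herm e0 e2 = - \<i>" "herm e1 e0 = 0" "herm e1 e1 = 1"
    "herm e1 e2 = 0" "herm e2 e0 = \<i>" "herm e2 e1 = 0" "herm e2 e2 = 0"
  using assms herm_cnj[of e1 e0] herm_cnj[of e1 e2] by (auto simp: null_frame_def)

text \<open>The second argument is \<Gamma>_xx in the frame. \<open>e0\<close> and \<open>e2\<close>
  are null, paired with each other and orthogonal to \<open>e1\<close>, so \<open>q\<close> drops
  out; the \<open>p\<close> term is cnj(i) times -i, that is -1.\<close>

lemma null_frame_combination:
  assumes "null_frame e0 e1 e2"
  shows "herm (p *s e0 + q *s e1 + r *s e2) (\<i> *s e2 + of_real k *s e0) = \<i> * of_real k * r - p"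
  using null_frame_herm[OF assms]
  by (simp add: herm_add_left herm_add_right herm_smult_left herm_smult_right algebra_simps)

lemma has_vector_derivative_of_real:
  assumes "(f has_real_derivative f') (at x)"
  shows "((\<lambda>x. of_real (f x) :: complex) has_vector_derivative of_real f') (at x)"
  using bounded_linear.has_vector_derivative[OF bounded_linear_of_real] assms
  by (simp add: has_real_derivative_iff_has_vector_derivative)

text \<open>These are the frame equations for complex coefficients at arclength, so
  \<open>r x\<close> enters the \<Gamma> component with factor 1.\<close>

lemma frame_combination_has_vector_derivative:
  fixes \<Gamma> T N :: "real \<Rightarrow> complex ^ 3"
  assumes "(\<Gamma> has_vector_derivative T x) (at x)"
    "(T has_vector_derivative (\<i> *s N x + of_real k *s \<Gamma> x)) (at x)"
    "(N has_vector_derivative (\<Gamma> x - (\<i> * of_real k) *s T x)) (at x)"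
    "(p has_vector_derivative p') (at x)"
    "(q has_vector_derivative q') (at x)"
    "(r has_vector_derivative r') (at x)"
  shows "((\<lambda>y. p y *s \<Gamma> y + q y *s T y + r y *s N y) has_vector_derivative
    ((p' + of_real k * q x + r x) *s \<Gamma> x + (p x + q' - \<i> * of_real k * r x) *s T x
      + (\<i> * q x + r') *s N x)) (at x)"
proof -
  note bb = bounded_bilinear.has_vector_derivative[OF bounded_bilinear_vector_scalar_mult]
  have "((\<lambda>y. p y *s \<Gamma> y + q y *s T y + r y *s N y) has_vector_derivative
    ((p x *s T x + p' *s \<Gamma> x) + (q x *s (\<i> *s N x + of_real k *s \<Gamma> x) + q' *s T x)
      + (r x *s (\<Gamma> x - (\<i> * of_real k) *s T x) + r' *s N x))) (at x)"
    by (intro has_vector_derivative_add bb assms)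
  then show ?thesis
    by (rule back_subst[where P = "\<lambda>D. (_ has_vector_derivative D) _"])
      (simp add: vec_eq_iff algebra_simps)
qed

text \<open>The velocity is kept in frame components throughout, so only scalar coefficients have to
  be differentiated. \<open>W1\<close> is obtained on all of \<open>I\<close> because it is
  differentiated once more; the imaginary \<Gamma> coefficient is an arbitrary \<open>b\<close>,
  since it contributes only imaginary terms to the pairing.\<close>

lemma velocity_second_derivative:
  fixes \<Gamma> T N :: "real \<Rightarrow> complex ^ 3" and a a1 a2 b b1 h h1 h2 h3 k k1 :: "real \<Rightarrow> real"
  assumes x: "x \<in> I"
    and frame: "null_frame (\<Gamma> x) (T x) (N x)"
    and \<Gamma>: "\<And>y. y \<in> I \<Longrightarrow> (\<Gamma> has_vector_derivative T y) (at y)"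
    and T: "\<And>y. y \<in> I \<Longrightarrow> (T has_vector_derivative (\<i> *s N y + of_real (k y) *s \<Gamma> y)) (at y)"
    and N: "\<And>y. y \<in> I \<Longrightarrow> (N has_vector_derivative (\<Gamma> y - (\<i> * of_real (k y)) *s T y)) (at y)"
    and k: "\<And>y. y \<in> I \<Longrightarrow> (k has_real_derivative k1 y) (at y)"
    and a: "\<And>y. y \<in> I \<Longrightarrow> (a has_real_derivative a1 y) (at y)"
      "\<And>y. y \<in> I \<Longrightarrow> (a1 has_real_derivative a2 y) (at y)"
      "\<And>y. y \<in> I \<Longrightarrow> (a2 has_real_derivative a3 y) (at y)"
    and b: "\<And>y. y \<in> I \<Longrightarrow> (b has_real_derivative b1 y) (at y)"
      "\<And>y. y \<in> I \<Longrightarrow> (b1 has_real_derivative b2 y) (at y)"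
    and h: "\<And>y. y \<in> I \<Longrightarrow> (h has_real_derivative h1 y) (at y)"
      "\<And>y. y \<in> I \<Longrightarrow> (h1 has_real_derivative h2 y) (at y)"
      "\<And>y. y \<in> I \<Longrightarrow> (h2 has_real_derivative h3 y) (at y)"
  obtains W1 W2 where
    "\<And>y. y \<in> I \<Longrightarrow> ((\<lambda>y. (- of_real (a1 y) - \<i> * of_real (b y)) *s \<Gamma> y
        + (of_real (a y) + 1/2 * \<i> * of_real (h1 y)) *s T y + of_real (h y) *s N y)
        has_vector_derivative W1 y) (at y)"
    "(W1 has_vector_derivative W2) (at x)"
    "2 * Re (herm W2 (\<i> *s N x + of_real (k x) *s \<Gamma> x))
        = 2 * a3 x - 4 * k x * a1 x - 2 * k1 x * a x - 3 * h1 x"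
proof -
  note r = has_vector_derivative_of_real
  define \<alpha> \<alpha>1 \<alpha>2 :: "real \<Rightarrow> complex"
    where "\<alpha> y = - of_real (a1 y) - \<i> * of_real (b y)"
      and "\<alpha>1 y = - of_real (a2 y) - \<i> * of_real (b1 y)"
      and "\<alpha>2 y = - of_real (a3 y) - \<i> * of_real (b2 y)" for y
  define \<beta> \<beta>1 \<beta>2 :: "real \<Rightarrow> complex"
    where "\<beta> y = of_real (a y) + 1/2 * \<i> * of_real (h1 y)"
      and "\<beta>1 y = of_real (a1 y) + 1/2 * \<i> * of_real (h2 y)"
      and "\<beta>2 y = of_real (a2 y) + 1/2 * \<i> * of_real (h3 y)" for y
  have d\<alpha>: "(\<alpha> has_vector_derivative \<alpha>1 y) (at y)" "(\<alpha>1 has_vector_derivative \<alpha>2 y) (at y)"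
    and d\<beta>: "(\<beta> has_vector_derivative \<beta>1 y) (at y)" "(\<beta>1 has_vector_derivative \<beta>2 y) (at y)"
    if "y \<in> I" for y
    unfolding \<alpha>_def \<alpha>1_def \<alpha>2_def \<beta>_def \<beta>1_def \<beta>2_def using that
    by (intro has_vector_derivative_diff has_vector_derivative_minus has_vector_derivative_add
        has_vector_derivative_mult_right r a b h; simp)+
  \<comment> \<open>These are the components of the first derivative. The real part -a' of
    \<open>\<alpha>\<close> cancels that of \<open>\<beta>1\<close>, so \<open>B\<close> is purely
    imaginary, as constancy of the norm of \<open>T\<close> demands.\<close>
  define A B C :: "real \<Rightarrow> complex"
    where "A y = \<alpha>1 y + of_real (k y) * \<beta> y + of_real (h y)"
      and "B y = \<alpha> y + \<beta>1 y - \<i> * of_real (k y) * of_real (h y)"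
      and "C y = \<i> * \<beta> y + of_real (h1 y)" for y
  define A' B' C' :: complex
    where "A' = \<alpha>2 x + (of_real (k x) * \<beta>1 x + of_real (k1 x) * \<beta> x) + of_real (h1 x)"
      and "B' = \<alpha>1 x + \<beta>2 x - (\<i> * of_real (k x) * of_real (h1 x) + \<i> * of_real (k1 x) * of_real (h x))"
      and "C' = \<i> * \<beta>1 x + of_real (h2 x)"
  have dA: "(A has_vector_derivative A') (at x)" and dB: "(B has_vector_derivative B') (at x)"
    and dC: "(C has_vector_derivative C') (at x)"
    unfolding A_def B_def C_def A'_def B'_def C'_def
    by (intro has_vector_derivative_diff has_vector_derivative_add has_vector_derivative_mult
        has_vector_derivative_mult_right d\<alpha> d\<beta> r k h x)+
  define W1 where "W1 y = A y *s \<Gamma> y + B y *s T y + C y *s N y" for y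
  define P where "P = A' + of_real (k x) * B x + C x"
  define Q where "Q = A x + B' - \<i> * of_real (k x) * C x"
  define R where "R = \<i> * B x + C'"
  have "((\<lambda>y. \<alpha> y *s \<Gamma> y + \<beta> y *s T y + of_real (h y) *s N y) has_vector_derivative W1 y) (at y)"
    if "y \<in> I" for y
    unfolding W1_def A_def B_def C_def
    by (rule frame_combination_has_vector_derivative) (intro \<Gamma> T N d\<alpha> d\<beta> r h that)+
  moreover have "(W1 has_vector_derivative (P *s \<Gamma> x + Q *s T x + R *s N x)) (at x)"
    unfolding W1_def P_def Q_def R_def
    by (rule frame_combination_has_vector_derivative) (intro \<Gamma> T N dA dB dC x)+
  \<comment> \<open>The pairing is i k R - P. The real part of \<open>P\<close> contains 3/2 h',
    made up of h' from \<open>A'\<close> and h'/2 from \<open>C\<close>; the imaginary part of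
    \<open>R\<close> is a'. Doubling gives -3 h' and turns the two terms k a' into 4 k a'.\<close>
  moreover have "2 * Re (herm (P *s \<Gamma> x + Q *s T x + R *s N x) (\<i> *s N x + of_real (k x) *s \<Gamma> x))
      = 2 * a3 x - 4 * k x * a1 x - 2 * k1 x * a x - 3 * h1 x"
    unfolding null_frame_combination[OF frame]
    by (simp add: P_def R_def A'_def B_def C_def C'_def \<alpha>_def \<alpha>2_def \<beta>_def \<beta>1_def algebra_simps)
  ultimately show thesis
    unfolding \<alpha>_def \<beta>_def by (rule that)
qed

text \<open>\<open>H n\<close> stands for the n-th derivative of L_j, hence \<open>H (Suc n)\<close>
  for that of K_j: \<open>H 7\<close> is the leading term of the recursion. Since m' is expressed by
  \<open>H 1\<close>, the derivatives of \<open>S\<close> are explicit, and comparing coefficients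
  settles the identity.\<close>

lemma KK_Suc_Suc_factorization:
  fixes u H :: "nat \<Rightarrow> real \<Rightarrow> real" and m S :: "real \<Rightarrow> real"
  assumes u: "\<And>n y. y \<in> I \<Longrightarrow> (u n has_real_derivative u (Suc n) y) (at y)"
    and H: "\<And>n y. y \<in> I \<Longrightarrow> (H n has_real_derivative H (Suc n) y) (at y)"
    and m: "\<And>y. y \<in> I \<Longrightarrow> (m has_real_derivative (u 2 y + 2 * (u 0 y)\<^sup>2) * H 1 y) (at y)"
    and S: "\<And>y. S y = m y + (H 4 y + 5 * u 0 y * H 2 y + 5/2 * u 1 y * H 1 y
      + (u 2 y + 2 * (u 0 y)\<^sup>2) * H 0 y)"
  obtains S1 S2 S3 where
    "\<And>y. y \<in> I \<Longrightarrow> (S has_real_derivative S1 y) (at y)"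
    "\<And>y. y \<in> I \<Longrightarrow> (S1 has_real_derivative S2 y) (at y)"
    "\<And>y. y \<in> I \<Longrightarrow> (S2 has_real_derivative S3 y) (at y)"
    "\<And>y. S3 y + u 0 y * S1 y + 1/2 * u 1 y * S y =
        H 7 y + 6 * u 0 y * H 5 y + 18 * u 1 y * H 4 y + (9 * (u 0 y)\<^sup>2 + 49/2 * u 2 y) * H 3 y
        + (30 * u 1 y * u 0 y + 35/2 * u 3 y) * H 2 y
        + (13/2 * u 4 y + 41/2 * u 2 y * u 0 y + 69/4 * (u 1 y)\<^sup>2 + 4 * (u 0 y) ^ 3) * H 1 y
        + (u 5 y + 5 * u 0 y * u 3 y + 25/2 * u 1 y * u 2 y + 5 * (u 0 y)\<^sup>2 * u 1 y) * H 0 y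
        + 1/2 * u 1 y * m y"
proof -
  define S1 where "S1 y = H 5 y + 5 * u 0 y * H 3 y + 15/2 * u 1 y * H 2 y
      + (9/2 * u 2 y + 4 * (u 0 y)\<^sup>2) * H 1 y + (u 3 y + 4 * u 0 y * u 1 y) * H 0 y" for y
  define S2 where "S2 y = H 6 y + 5 * u 0 y * H 4 y + 25/2 * u 1 y * H 3 y
      + (12 * u 2 y + 4 * (u 0 y)\<^sup>2) * H 2 y + (11/2 * u 3 y + 12 * u 0 y * u 1 y) * H 1 y
      + (u 4 y + 4 * (u 1 y)\<^sup>2 + 4 * u 0 y * u 2 y) * H 0 y" for y
  define S3 where "S3 y = H 7 y + 5 * u 0 y * H 5 y + 35/2 * u 1 y * H 4 y
      + (49/2 * u 2 y + 4 * (u 0 y)\<^sup>2) * H 3 y + (35/2 * u 3 y + 20 * u 0 y * u 1 y) * H 2 y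
      + (13/2 * u 4 y + 16 * (u 1 y)\<^sup>2 + 16 * u 0 y * u 2 y) * H 1 y
      + (u 5 y + 12 * u 1 y * u 2 y + 4 * u 0 y * u 3 y) * H 0 y" for y
  have num: "Suc 0 = 1" "Suc 1 = 2" "Suc 2 = 3" "Suc 3 = 4" "Suc 4 = 5" "Suc 5 = 6" "Suc 6 = 7"
    by simp_all
  have "(S has_real_derivative S1 y) (at y)" "(S1 has_real_derivative S2 y) (at y)"
    "(S2 has_real_derivative S3 y) (at y)" if "y \<in> I" for y
    unfolding S[abs_def] S1_def[abs_def] S2_def[abs_def] S3_def
    by (auto intro!: derivative_eq_intros u[OF that] H[OF that] m[OF that]
        simp: num field_simps power2_eq_square simp del: One_nat_def)
  moreover have "S3 y + u 0 y * S1 y + 1/2 * u 1 y * S y =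
        H 7 y + 6 * u 0 y * H 5 y + 18 * u 1 y * H 4 y + (9 * (u 0 y)\<^sup>2 + 49/2 * u 2 y) * H 3 y
        + (30 * u 1 y * u 0 y + 35/2 * u 3 y) * H 2 y
        + (13/2 * u 4 y + 41/2 * u 2 y * u 0 y + 69/4 * (u 1 y)\<^sup>2 + 4 * (u 0 y) ^ 3) * H 1 y
        + (u 5 y + 5 * u 0 y * u 3 y + 25/2 * u 1 y * u 2 y + 5 * (u 0 y)\<^sup>2 * u 1 y) * H 0 y
        + 1/2 * u 1 y * m y" for y
    by (simp add: S S1_def S3_def field_simps power2_eq_square power3_eq_cube)
  ultimately show thesis
    by (rule that)
qed

theorem theorem9:
  fixes j :: nat
    and L M :: "nat \<Rightarrow> jet_fun"
    and I J :: "real set"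
    and \<gamma> :: "real \<Rightarrow> real \<Rightarrow> (complex^3) set"
    and \<Gamma> T N :: "real \<Rightarrow> real \<Rightarrow> complex^3"
    and k l u h a :: "real \<Rightarrow> real \<Rightarrow> real"
  assumes "KK_antiderivatives L M"
    and "open I" "is_interval I" "open J" "is_interval J"
    and "smooth_on (J \<times> I) (\<lambda>(t, x). \<Gamma> t x)"
    and "\<And>t. t \<in> J \<Longrightarrow> normalized_framing I (\<gamma> t) (\<Gamma> t) (T t) (N t) (k t) (l t)"
    and "\<And>t x. t \<in> J \<Longrightarrow> x \<in> I \<Longrightarrow> l t x = 1"
    and "\<And>t x. u t x = - 2 * k t x"
    and "\<And>t x. h t x = ev (L j) (u t) x"
    and "\<And>t x. a t x = ev (flow_coeff (L j) (M j)) (u t) x"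
    and "\<And>t x. t \<in> J \<Longrightarrow> x \<in> I \<Longrightarrow>
      ((\<lambda>s. \<Gamma> s x) has_vector_derivative
        ((- of_real (deriv (a t) x)
            - 1/6 * \<i> * of_real (u t x * h t x + (deriv ^^ 2) (h t) x)) *s \<Gamma> t x
         + (of_real (a t x) + 1/2 * \<i> * of_real (deriv (h t) x)) *s T t x
         + of_real (h t x) *s N t x)) (at t)"
  shows "\<And>t x. t \<in> J \<Longrightarrow> x \<in> I \<Longrightarrow>
      ((\<lambda>s. u s x) has_real_derivative
        (1/9 * ev (KK L M (j + 2)) (u t) x - 3 * ev (KK L M j) (u t) x)) (at t)"
proof -
  fix t x assume t: "t \<in> J" and x: "x \<in> I"
  define G where "G = (\<lambda>(t, x). \<Gamma> t x)"
  define X where "X = pdir (0, 1) G"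
  define XX where "XX = pdir (0, 1) X"
  \<comment> \<open>\<open>U\<close> is built from \<open>\<Gamma>\<close> alone, so it inherits
    joint smoothness and gives access to the time derivative of \<open>u\<close>.\<close>
  define U where "U p = Re (herm (XX p) (XX p))" for p
  have S: "open (J \<times> I)"
    by (intro open_Times assms)
  have sG: "smooth_on (J \<times> I) G" and sX: "smooth_on (J \<times> I) X" and sXX: "smooth_on (J \<times> I) XX"
    using assms(6) by (auto simp: G_def X_def XX_def intro!: smooth_on_pdir)
  have frame: "null_frame (\<Gamma> s y) (T s y) (N s y)"
    and d\<Gamma>: "(\<Gamma> s has_vector_derivative T s y) (at y)"
    and dT: "(T s has_vector_derivative (\<i> *s N s y + of_real (k s y) *s \<Gamma> s y)) (at y)"
    and dN: "(N s has_vector_derivative (\<Gamma> s y - (\<i> * of_real (k s y)) *s T s y)) (at y)"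
    if "s \<in> J" "y \<in> I" for s y
    using assms(7)[OF that(1)] assms(8)[OF that] that(2) by (auto simp: normalized_framing_def)
  have X: "X (s, y) = T s y" if "s \<in> J" "y \<in> I" for s y
    using vector_derivative_unique_at[OF d\<Gamma>[OF that]] smooth_on_has_partial_snd[OF sG, of s y] that
    by (simp add: G_def X_def)
  have XX: "XX (s, y) = \<i> *s N s y + of_real (k s y) *s \<Gamma> s y" if "s \<in> J" "y \<in> I" for s y
  \<comment> \<open>\<open>X\<close> and \<open>T s\<close> agree on the open set \<open>I\<close>,
    so the frame equation for \<open>T\<close> identifies the x-derivative of
    \<open>X\<close>.\<close>
  proof -
    have "(T s has_vector_derivative XX (s, y)) (at y)"
      using has_vector_derivative_transform_within_open[OF smooth_on_has_partial_snd[OF sX] assms(2)]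
        that X by (simp add: XX_def)
    then show ?thesis
      by (rule vector_derivative_unique_at[OF _ dT[OF that]])
  qed
  \<comment> \<open>The coefficients k, 0, i of \<Gamma>_xx itself give i k i - k = -2k.\<close>
  have U: "u s y = U (s, y)" if "s \<in> J" "y \<in> I" for s y
    using null_frame_combination[OF frame[OF that], of "of_real (k s y)" 0 \<i> "k s y"]
    by (simp add: U_def XX[OF that] assms(9) add.commute)
  have sU: "smooth_on (J \<times> I) U"
  proof -
    have "bounded_bilinear (\<lambda>z w. Re (herm z w))"
      using bounded_bilinear_herm unfolding bilinear_conv_bounded_bilinear[symmetric] bilinear_def
      by (auto simp: linear_iff)
    then show ?thesis
      unfolding U_def[abs_def] by (rule bounded_bilinear.smooth_on) (intro S sXX)+
  qed
  define v where "v n = (deriv ^^ n) (u t)" for n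
  define H where "H n = ev ((D ^^ n) (L j)) (u t)" for n
  define m where "m = ev (M j) (u t)"
  have dv: "(v n has_real_derivative v (Suc n) y) (at y)" if "y \<in> I" for n y
    unfolding v_def by (rule funpow_deriv_slice[OF assms(2) sU t that U[OF t]])
  have diff: "(deriv ^^ n) (u t) field_differentiable at y" if "y \<in> I" for n y
    using dv[OF that, of n] by (auto simp: v_def field_differentiable_def)
  have L: "local_fun (L j)" "D (L j) = KK L M j"
    and M: "local_fun (M j)" "D (M j) = (\<lambda>v. (v 2 + 2 * (v 0)\<^sup>2) * KK L M j v)"
    using assms(1) by (auto simp: KK_antiderivatives_def)
  have dH: "(H n has_real_derivative H (Suc n) y) (at y)" if "y \<in> I" for n y
    using DERIV_ev[OF local_fun_D_funpow[OF L(1)] diff[OF that]] by (simp add: H_def)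
  have dm: "(m has_real_derivative (v 2 y + 2 * (v 0 y)\<^sup>2) * H 1 y) (at y)" if "y \<in> I" for y
    using DERIV_ev[OF M(1) diff[OF that]] by (simp add: m_def H_def v_def M L(2) ev_def)
  have h0: "h t = H 0"
    by (simp add: fun_eq_iff H_def assms(10))
  have h1: "deriv (h t) y = H 1 y" if "y \<in> I" for y
    using DERIV_imp_deriv[OF dH[OF that, of 0]] by (simp add: h0)
  have "(deriv (h t) has_real_derivative H 2 y) (at y)" if "y \<in> I" for y
    using dH[OF that, of 1] has_field_derivative_transform_within_open[OF _ assms(2) that h1[symmetric]]
    by (simp add: numeral_2_eq_2)
  then have h2: "(deriv ^^ 2) (h t) y = H 2 y" if "y \<in> I" for y
    using that by (simp add: numeral_2_eq_2 DERIV_imp_deriv)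
  \<comment> \<open>This is 18 a, with \<open>m\<close> in the role of M_j.\<close>
  define S where "S y = m y + (H 4 y + 5 * v 0 y * H 2 y + 5/2 * v 1 y * H 1 y
      + (v 2 y + 2 * (v 0 y)\<^sup>2) * H 0 y)" for y
  have a: "a t y = 1/18 * S y" for y
    by (simp add: assms(11) flow_coeff_def ev_def m_def H_def v_def S_def)
  obtain S1 S2 S3 where
    dS: "\<And>y. y \<in> I \<Longrightarrow> (S has_real_derivative S1 y) (at y)"
      "\<And>y. y \<in> I \<Longrightarrow> (S1 has_real_derivative S2 y) (at y)"
      "\<And>y. y \<in> I \<Longrightarrow> (S2 has_real_derivative S3 y) (at y)"
    and S3: "\<And>y. S3 y + v 0 y * S1 y + 1/2 * v 1 y * S y =
        H 7 y + 6 * v 0 y * H 5 y + 18 * v 1 y * H 4 y + (9 * (v 0 y)\<^sup>2 + 49/2 * v 2 y) * H 3 y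
        + (30 * v 1 y * v 0 y + 35/2 * v 3 y) * H 2 y
        + (13/2 * v 4 y + 41/2 * v 2 y * v 0 y + 69/4 * (v 1 y)\<^sup>2 + 4 * (v 0 y) ^ 3) * H 1 y
        + (v 5 y + 5 * v 0 y * v 3 y + 25/2 * v 1 y * v 2 y + 5 * (v 0 y)\<^sup>2 * v 1 y) * H 0 y
        + 1/2 * v 1 y * m y"
    by (rule KK_Suc_Suc_factorization[where I = I, OF dv dH dm S_def]) (assumption | rule that; blast)+
  have da: "(a t has_real_derivative 1/18 * S1 y) (at y)"
    "((\<lambda>y. 1/18 * S1 y) has_real_derivative 1/18 * S2 y) (at y)"
    "((\<lambda>y. 1/18 * S2 y) has_real_derivative 1/18 * S3 y) (at y)" if "y \<in> I" for y
    unfolding a[abs_def] by (intro DERIV_cmult dS that)+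
  define b b1 b2 where "b y = 1/6 * (v 0 y * H 0 y + H 2 y)"
    and "b1 y = 1/6 * (v 0 y * H 1 y + v 1 y * H 0 y + H 3 y)"
    and "b2 y = 1/6 * (v 0 y * H 2 y + v 1 y * H 1 y + (v 1 y * H 1 y + v 2 y * H 0 y) + H 4 y)" for y
  have num: "Suc 0 = 1" "Suc 1 = 2" "Suc 2 = 3" "Suc 3 = 4"
    by simp_all
  have db: "(b has_real_derivative b1 y) (at y)" "(b1 has_real_derivative b2 y) (at y)" if "y \<in> I" for y
    unfolding b_def b1_def b2_def
    by (auto intro!: derivative_eq_intros dv[OF that] dH[OF that] simp: num field_simps
        simp del: One_nat_def)
  have dH012: "(H 0 has_real_derivative H 1 y) (at y)" "(H 1 has_real_derivative H 2 y) (at y)"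
    "(H 2 has_real_derivative H 3 y) (at y)" if "y \<in> I" for y
    using dH[OF that, of 0] dH[OF that, of 1] dH[OF that, of 2] by (simp_all only: num)
  have dk: "(k t has_real_derivative - 1/2 * v 1 y) (at y)" if "y \<in> I" for y
  proof -
    have "k t = (\<lambda>y. - 1/2 * v 0 y)"
      by (simp add: v_def assms(9) fun_eq_iff)
    then show ?thesis
      using DERIV_cmult[OF dv[OF that, of 0], of "- 1/2"] by simp
  qed
  obtain W1 W2 where
    W1: "\<And>y. y \<in> I \<Longrightarrow> ((\<lambda>y. (- of_real (1/18 * S1 y) - \<i> * of_real (b y)) *s \<Gamma> t y
        + (of_real (a t y) + 1/2 * \<i> * of_real (H 1 y)) *s T t y + of_real (H 0 y) *s N t y)
        has_vector_derivative W1 y) (at y)"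
    and W2: "(W1 has_vector_derivative W2) (at x)"
    and speed: "2 * Re (herm W2 (\<i> *s N t x + of_real (k t x) *s \<Gamma> t x))
        = 2 * (1/18 * S3 x) - 4 * k t x * (1/18 * S1 x) - 2 * (- 1/2 * v 1 x) * a t x - 3 * H 1 x"
    by (rule velocity_second_derivative[where I = I,
          OF x frame[OF t x] d\<Gamma>[OF t] dT[OF t] dN[OF t] dk da db dH012])
      (assumption | rule that; blast)+
  \<comment> \<open>The evolution equation with its \<open>deriv\<close> expressions evaluated,
    valid for all y in \<open>I\<close>, so that it can be differentiated in x.\<close>
  have W: "pdir (1, 0) G (t, y) = (- of_real (1/18 * S1 y) - \<i> * of_real (b y)) *s \<Gamma> t y
        + (of_real (a t y) + 1/2 * \<i> * of_real (H 1 y)) *s T t y + of_real (H 0 y) *s N t y"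
    if y: "y \<in> I" for y
  proof -
    have b: "1/6 * \<i> * of_real (u t y * h t y + (deriv ^^ 2) (h t) y) = \<i> * of_real (b y)"
      by (simp add: h2[OF y, unfolded h0] b_def h0 v_def)
    have "((\<lambda>s. \<Gamma> s y) has_vector_derivative pdir (1, 0) G (t, y)) (at t)"
      using smooth_on_has_partial_fst[OF sG, of t y] t y by (simp add: G_def)
    then show ?thesis
      by (rule vector_derivative_unique_at)
        (use assms(12)[OF t y, unfolded b h1[OF y] DERIV_imp_deriv[OF da(1)[OF y]], unfolded h0] in simp)
  qed
  \<comment> \<open>Time and space derivatives are exchanged twice: here T_t is the x-derivative of
    \<Gamma>_t, and below the time derivative of \<Gamma>_xx is the x-derivative of T_t.\<close>
  have W1': "pdir (1, 0) X (t, y) = W1 y" if y: "y \<in> I" for y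
  proof -
    have "pdir (1, 0) X (t, y) = pdir (0, 1) (pdir (1, 0) G) (t, y)"
      unfolding X_def using t y by (intro pdir_commute[OF S sG]) simp
    moreover have "((\<lambda>y. pdir (1, 0) G (t, y)) has_vector_derivative W1 y) (at y)"
      by (rule has_vector_derivative_transform_within_open[OF W1[OF y] assms(2) y]) (simp add: W)
    moreover have "((\<lambda>y. pdir (1, 0) G (t, y)) has_vector_derivative
        pdir (0, 1) (pdir (1, 0) G) (t, y)) (at y)"
      using t y by (intro smooth_on_has_partial_snd[OF smooth_on_pdir[OF sG]]) simp
    ultimately show ?thesis
      using vector_derivative_unique_at by metis
  qed
  have W2': "pdir (1, 0) XX (t, x) = W2"
  proof -
    have "pdir (1, 0) XX (t, x) = pdir (0, 1) (pdir (1, 0) X) (t, x)"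
      unfolding XX_def using t x by (intro pdir_commute[OF S sX]) simp
    moreover have "((\<lambda>y. pdir (1, 0) X (t, y)) has_vector_derivative W2) (at x)"
      by (rule has_vector_derivative_transform_within_open[OF W2 assms(2) x]) (simp add: W1')
    moreover have "((\<lambda>y. pdir (1, 0) X (t, y)) has_vector_derivative
        pdir (0, 1) (pdir (1, 0) X) (t, x)) (at x)"
      using t x by (intro smooth_on_has_partial_snd[OF smooth_on_pdir[OF sX]]) simp
    ultimately show ?thesis
      using vector_derivative_unique_at by metis
  qed
  have "((\<lambda>s. XX (s, x)) has_vector_derivative W2) (at t)"
    using smooth_on_has_partial_fst[OF sXX, of t x] t x W2' by simp
  then have "((\<lambda>s. U (s, x)) has_vector_derivative
      Re (herm (XX (t, x)) W2 + herm W2 (XX (t, x)))) (at t)"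
    unfolding U_def
    by (intro bounded_linear.has_vector_derivative[OF bounded_linear_Re]
        bounded_bilinear.has_vector_derivative[OF bounded_bilinear_herm])
  \<comment> \<open>The two terms of the product rule are complex conjugates of each other.\<close>
  moreover have "Re (herm (XX (t, x)) W2 + herm W2 (XX (t, x))) = 2 * Re (herm W2 (XX (t, x)))"
    using herm_cnj[of "XX (t, x)" W2] by simp
  ultimately have "((\<lambda>s. U (s, x)) has_real_derivative 2 * Re (herm W2 (XX (t, x)))) (at t)"
    by (simp add: has_real_derivative_iff_has_vector_derivative)
  then have "((\<lambda>s. u s x) has_real_derivative 2 * Re (herm W2 (XX (t, x)))) (at t)"
    by (rule has_field_derivative_transform_within_open[OF _ assms(4) t]) (simp add: U x)
  moreover have "2 * Re (herm W2 (XX (t, x))) =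
      1/9 * ev (KK L M (j + 2)) (u t) x - 3 * ev (KK L M j) (u t) x"
  proof -
    \<comment> \<open>Derivatives of K_j are derivatives of L_j of one order higher, which matches
      the recursion with the functions \<open>H n\<close>.\<close>
    have pow: "(D ^^ n) (KK L M j) = (D ^^ Suc n) (L j)" for n
      by (simp add: funpow_swap1 L(2))
    have "ev (KK L M (j + 2)) (u t) x =
        S3 x + v 0 x * S1 x + 1/2 * v 1 x * (18 * a t x)"
      using S3[of x] L(2)
      by (simp add: a KK_rec_def KK1_def ev_def v_def H_def m_def pow[simplified] eval_nat_numeral)
    moreover have "ev (KK L M j) (u t) x = H 1 x"
      by (simp add: H_def L(2))
    moreover have "k t x = - 1/2 * v 0 x"
      by (simp add: v_def assms(9))
    \<comment> \<open>With a = S/18 and k = -u/2 the terms in a become 2/18 times K_{j+2}, and h' is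
      K_j.\<close>
    ultimately show ?thesis
      unfolding XX[OF t x] speed by (simp add: field_simps)
  qed
  ultimately show "((\<lambda>s. u s x) has_real_derivative
      (1/9 * ev (KK L M (j + 2)) (u t) x - 3 * ev (KK L M j) (u t) x)) (at t)"
    by simp
qed

end
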